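(* Let $w\in S_n$ be a nonidentity sorted permutation with orthodontic sequence $\bm{i}(w)=(i_1,\ldots,i_\ell)$, $\bm{k}(w)=(k_1,\ldots,k_n)$, $\bm{m}(w)=(m_1,\ldots,m_\ell)$, and primary column data $(h,C,\alpha,i_1,\beta)$ (the first entry of $\bm{i}(w)$ being this $i_1$). Then: (i) for $j\in[\beta]$, $i_j=i_1-j+1$; (ii) if $\alpha>0$ then $k_\alpha\ge\beta$; (iii) for $j\in[\alpha+1,i_1]$, $k_j=0$; (iv) for $j\in[\beta-1]$, $m_j=0$; (v) the permutation $ws_{i_1}s_{i_1-1}\cdots s_{\alpha+1}$ has orthodontic sequence $\bm{i}=(i_{\beta+1},\ldots,i_\ell)$, $\bm{m}=(m_{\beta+1},\ldots,m_\ell)$, and $\bm{k}=(k_1,\ldots,k_{\alpha-1},k_\alpha-\beta,\beta+m_\beta,k_{\alpha+2},\ldots,k_n)$ if $\alpha>0$, respectively $\bm{k}=(\beta+m_\beta,k_2,\ldots,k_n)$ if $\alpha=0$.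
   Context: $[m,n]=\{m,\ldots,n\}$, $[n]=[1,n]$, $[0]=\emptyset$. $s_j$ adjacent transposition; permutations act on the right on positions, so $ws_j$ is $w$ with $w(j),w(j+1)$ swapped. Rothe diagram $D(w)=\{(i,j)\in[n]^2: i<w^{-1}(j),\ j<w(i)\}$ (row $i$, column $j$), columns $D(w)_j=\{i:(i,j)\in D(w)\}$. Standard interval: $[j]$, $j\ge0$. Dominant: all columns of $D(w)$ are standard intervals. Missing tooth of a column $C$: $i\ge1$ with $i\notin C$, $i+1\in C$. Primary column data: if $w$ is not dominant, $h$ minimal with $D(w)_{h+1}$ not a standard interval, $C=D(w)_{h+1}$, $\alpha$ maximal with $[\alpha]\subseteq C$, $i_1$ the smallest missing tooth of $C$, $\beta=i_1-\alpha$; if $w$ dominant, $(h,C,\alpha,i_1,\beta)=(n,\emptyset,0,n,n)$. Then $w$ maps $[\alpha+1,i_1]$ bijectively onto $[h-\beta+1,h]$; $\sigma(w)\in S_\beta$ is $\sigma(w)(p)=w(\alpha+p)-(h-\beta)$; $w$ is sorted if $\sigma(w)$ is the identity, i.e. $w(\alpha+1)<\cdots<w(i_1)$. Orthodontic sequence: start with $D=D(w)$. For $j\in[n]$ let $k_j$ be the number of columns equal to $[j]$; replace them by empty columns. If nonempty columns remain, let $i_1$ be the smallest missing tooth of the leftmost nonempty column and swap rows $i_1,i_1+1$. Then $m_1$ is the number of columns equal to $[i_1]$ in the new diagram; empty them, let $i_2$ be the smallest missing tooth of the leftmost nonempty column, swap rows $i_2,i_2+1$, let $m_2$ be the number of columns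 equal to $[i_2]$, empty them, etc., until no nonempty columns remain after $\ell$ swaps. Output $\bm{i}(w)=(i_1,\ldots,i_\ell)$, $\bm{k}(w)=(k_1,\ldots,k_n)$, $\bm{m}(w)=(m_1,\ldots,m_\ell)$. *)

theory Defs
  imports "HOL-Combinatorics.Permutations"
begin

text \<open>
  Elements of \<open>S\<^sub>n\<close> are functions \<open>w\<close> with \<open>w permutes {1..n}\<close>. A diagram is a set of cells
  \<open>(row, column)\<close>; rows and columns are numbered from 1.
\<close>

type_synonym diagram = "(nat \<times> nat) set"

definition column :: "diagram \<Rightarrow> nat \<Rightarrow> nat set" where
  "column D j = {i. (i, j) \<in> D}"

definition rothe :: "nat \<Rightarrow> (nat \<Rightarrow> nat) \<Rightarrow> diagram" where
  "rothe n w = {(i, j). i \<in> {1..n} \<and> j \<in> {1..n} \<and> i < inv w j \<and> j < w i}"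

definition standard_interval :: "nat set \<Rightarrow> bool" where
  "standard_interval C \<longleftrightarrow> (\<exists>j. C = {1..j})"

definition dominant :: "nat \<Rightarrow> (nat \<Rightarrow> nat) \<Rightarrow> bool" where
  "dominant n w \<longleftrightarrow> (\<forall>j\<in>{1..n}. standard_interval (column (rothe n w) j))"

definition missing_tooth :: "nat set \<Rightarrow> nat \<Rightarrow> bool" where
  "missing_tooth C i \<longleftrightarrow> 1 \<le> i \<and> i \<notin> C \<and> i + 1 \<in> C"

definition smallest_missing_tooth :: "nat set \<Rightarrow> nat" where
  "smallest_missing_tooth C = (LEAST i. missing_tooth C i)"


subsection \<open>Primary column data and sorted permutations\<close>

text \<open>The components are \<open>(h, C, \<alpha>, i\<^sub>1, \<beta>)\<close>.\<close>

definition primary_column_data ::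
    "nat \<Rightarrow> (nat \<Rightarrow> nat) \<Rightarrow> nat \<times> nat set \<times> nat \<times> nat \<times> nat" where
  "primary_column_data n w =
    (if dominant n w then (n, {}, 0, n, n)
     else let h = (LEAST h. \<not> standard_interval (column (rothe n w) (h + 1)));
              C = column (rothe n w) (h + 1);
              \<alpha> = (GREATEST a. {1..a} \<subseteq> C);
              i\<^sub>1 = smallest_missing_tooth C
          in (h, C, \<alpha>, i\<^sub>1, i\<^sub>1 - \<alpha>))"

text \<open>
  The natural-number subtractions do not truncate, see \<open>primary_column_data_bij\<close> below.
\<close>

definition sigma :: "nat \<Rightarrow> (nat \<Rightarrow> nat) \<Rightarrow> nat \<Rightarrow> nat" where
  "sigma n w = (case primary_column_data n w of (h, C, \<alpha>, i\<^sub>1, \<beta>) \<Rightarrow>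
     (\<lambda>p. if p \<in> {1..\<beta>} then w (\<alpha> + p) - (h - \<beta>) else p))"

definition sorted_perm :: "nat \<Rightarrow> (nat \<Rightarrow> nat) \<Rightarrow> bool" where
  "sorted_perm n w \<longleftrightarrow> sigma n w = id"


subsection \<open>Orthodontic sequences\<close>

definition leftmost_column :: "diagram \<Rightarrow> nat set" where
  "leftmost_column D = column D (LEAST j. column D j \<noteq> {})"

definition swap_rows :: "nat \<Rightarrow> diagram \<Rightarrow> diagram" where
  "swap_rows i D = {(transpose i (i + 1) r, c) | r c. (r, c) \<in> D}"

definition count_columns :: "nat set \<Rightarrow> diagram \<Rightarrow> nat" where
  "count_columns C D = card {j. column D j = C}"

definition clear_columns :: "nat set set \<Rightarrow> diagram \<Rightarrow> diagram" where
  "clear_columns \<C> D = {(r, c). (r, c) \<in> D \<and> column D c \<notin> \<C>}"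

text \<open>
  \<open>orthodontia D is ms\<close>: the iterated part of the algorithm, started on \<open>D\<close>, halts with
  output \<open>is\<close>, \<open>ms\<close>.
\<close>

inductive orthodontia :: "diagram \<Rightarrow> nat list \<Rightarrow> nat list \<Rightarrow> bool" where
  halt: "orthodontia {} [] []"
| swap: "\<lbrakk>D \<noteq> {}; i = smallest_missing_tooth (leftmost_column D); D' = swap_rows i D;
     orthodontia (clear_columns {{1..i}} D') I M\<rbrakk>
     \<Longrightarrow> orthodontia D (i # I) (count_columns {1..i} D' # M)"

definition orthodontic_sequence ::
    "nat \<Rightarrow> (nat \<Rightarrow> nat) \<Rightarrow> nat list \<Rightarrow> nat list \<Rightarrow> nat list \<Rightarrow> bool" where
  "orthodontic_sequence n w I K M \<longleftrightarrow>
     K = map (\<lambda>j. count_columns {1..j} (rothe n w)) [1..<n + 1] \<and>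
     orthodontia (clear_columns {{1..j} | j. j \<in> {1..n}} (rothe n w)) I M"


subsection \<open>Right multiplication by a word of adjacent transpositions\<close>

definition right_mult_word :: "(nat \<Rightarrow> nat) \<Rightarrow> nat list \<Rightarrow> nat \<Rightarrow> nat" where
  "right_mult_word w js = foldl (\<lambda>v j. v \<circ> transpose j (j + 1)) w js"


subsection \<open>Existence and uniqueness of the orthodontic sequence\<close>

lemma smallest_missing_tooth:
  assumes "C \<noteq> {}" "finite C" "0 \<notin> C" "\<not> standard_interval C"
  shows "missing_tooth C (smallest_missing_tooth C)"
proof -
  have "\<exists>i. missing_tooth C i"
  proof (rule ccontr)
    assume *: "\<nexists>i. missing_tooth C i"
    have down: "i \<in> C" if "i + d \<in> C" "1 \<le> i" for i d
      using that
    proof (induction d)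
      case (Suc d)
      then have "i + d \<in> C"
        using * unfolding missing_tooth_def by (metis Suc_eq_plus1 add_Suc_right trans_le_add1)
      with Suc show ?case by blast
    qed simp
    have "C = {1..Max C}"
    proof
      show "C \<subseteq> {1..Max C}"
        using assms by (auto simp: Suc_le_eq intro!: gr0I)
      show "{1..Max C} \<subseteq> C"
      proof
        fix i assume i: "i \<in> {1..Max C}"
        then have "i + (Max C - i) \<in> C" using assms Max_in by simp
        then show "i \<in> C" using down[of i "Max C - i"] i by simp
      qed
    qed
    then show False using assms(4) unfolding standard_interval_def by blast
  qed
  then show ?thesis unfolding smallest_missing_tooth_def by (rule LeastI_ex)
qed

lemma column_swap_rows: "column (swap_rows i D) j = transpose i (i + 1) ` column D j"
  by (auto simp: column_def swap_rows_def)

lemma column_clear_columns: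
  "column (clear_columns \<C> D) j = (if column D j \<in> \<C> then {} else column D j)"
  by (auto simp: column_def clear_columns_def)

lemma orthodontia_exists:
  assumes "finite D" "\<And>j. 0 \<notin> column D j"
    "\<And>j. column D j \<noteq> {} \<Longrightarrow> \<not> standard_interval (column D j)"
  shows "\<exists>I M. orthodontia D I M"
  using assms
proof (induction D rule: wf_induct[OF wf_measures[of
      "[\<lambda>D. card {j. column D j \<noteq> {}}, \<lambda>D. \<Sum>(leftmost_column D)]"]])
  case (1 D)
  note IH = 1(1) and fin = 1(2) and pos = 1(3) and nstd = 1(4)
  show ?case
  proof (cases "D = {}")
    case True then show ?thesis using orthodontia.halt by blast
  next
    case False
    define c where "c = (LEAST j. column D j \<noteq> {})"
    define C where "C = column D c"
    define i where "i = smallest_missing_tooth C"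
    define D' where "D' = swap_rows i D"
    define E where "E = clear_columns {{1..i}} D'"
    have lm: "leftmost_column D = C" by (simp add: leftmost_column_def c_def C_def)
    have "\<exists>j. column D j \<noteq> {}" using False by (auto simp: column_def)
    then have C0: "C \<noteq> {}" unfolding C_def c_def by (rule LeastI_ex)
    have Cfin: "finite (column D j)" for j
      by (rule finite_subset[of _ "fst ` D"]) (use fin in \<open>force simp: column_def\<close>)+
    have i: "1 \<le> i" "i \<notin> C" "i + 1 \<in> C"
      using smallest_missing_tooth[of C] C0 Cfin pos nstd
      unfolding C_def i_def missing_tooth_def by blast+
    have colE: "column E j = (if transpose i (i + 1) ` column D j = {1..i} then {}
        else transpose i (i + 1) ` column D j)" for j
      by (simp add: E_def D'_def column_clear_columns column_swap_rows)
    have Efin: "finite E"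
    proof -
      have "D' \<subseteq> (\<lambda>(r, c). (transpose i (i + 1) r, c)) ` D"
        by (auto simp: D'_def swap_rows_def)
      moreover have "E \<subseteq> D'" by (auto simp: E_def clear_columns_def)
      ultimately show ?thesis using fin by (meson finite_imageI finite_subset)
    qed
    have Epos: "0 \<notin> column E j" for j
      using pos[of j] i(1) by (auto simp: colE transpose_def)
    have Enstd: "\<not> standard_interval (column E j)" if ne: "column E j \<noteq> {}" for j
    proof
      assume "standard_interval (column E j)"
      then obtain k where k: "column E j = {1..k}" unfolding standard_interval_def by blast
      have T: "transpose i (i + 1) ` column D j = {1..k}" "k \<noteq> i"
        using k ne colE[of j] by (auto split: if_splits)
      have "column D j = transpose i (i + 1) ` {1..k}"
        unfolding T(1)[symmetric] image_image by simp
      also have "\<dots> = {1..k}"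
      proof -
        have "transpose i (i + 1) ` {1..k} \<subseteq> {1..k}"
          using \<open>k \<noteq> i\<close> i(1) by (auto simp: transpose_def)
        then show ?thesis
          by (intro card_subset_eq) (auto simp: card_image)
      qed
      finally have "column D j = {1..k}" .
      moreover have "column D j \<noteq> {}" using ne colE[of j] by (auto split: if_splits)
      ultimately show False using nstd[of j] unfolding standard_interval_def by blast
    qed
    have sub: "{j. column E j \<noteq> {}} \<subseteq> {j. column D j \<noteq> {}}"
      by (auto simp: colE split: if_splits)
    have Dcols: "finite {j. column D j \<noteq> {}}"
      by (rule finite_subset[of _ "snd ` D"]) (use fin in \<open>force simp: column_def\<close>)+
    have dec: "(E, D) \<in> measures [\<lambda>D. card {j. column D j \<noteq> {}}, \<lambda>D. \<Sum>(leftmost_column D)]"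
    proof (cases "column E c = {}")
      case True
      then have "{j. column E j \<noteq> {}} \<subset> {j. column D j \<noteq> {}}"
        using sub C0 C_def by blast
      then show ?thesis using Dcols by (simp add: psubset_card_mono)
    next
      case False
      have "(LEAST j. column E j \<noteq> {}) = c"
      proof (rule Least_equality)
        show "column E c \<noteq> {}" by (rule False)
      next
        fix j assume "column E j \<noteq> {}"
        then have "column D j \<noteq> {}" using sub by blast
        then show "c \<le> j" unfolding c_def by (rule Least_le)
      qed
      then have "leftmost_column E = transpose i (i + 1) ` C"
        using False by (auto simp: leftmost_column_def colE C_def split: if_splits)
      also have "\<dots> = insert i (C - {i + 1})"
        using i by (auto simp: transpose_def image_iff)
      finally have "\<Sum>(leftmost_column E) = i + \<Sum>(C - {i + 1})"
        using i Cfin[of c] C_def by simp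
      moreover have "\<Sum>C = (i + 1) + \<Sum>(C - {i + 1})"
        using i Cfin[of c] C_def by (simp add: sum.remove)
      moreover have "card {j. column E j \<noteq> {}} \<le> card {j. column D j \<noteq> {}}"
        using sub Dcols by (rule card_mono[rotated])
      ultimately show ?thesis by (auto simp: lm)
    qed
    obtain I M where "orthodontia E I M"
      using IH dec Efin Epos Enstd by metis
    then show ?thesis
      using orthodontia.swap[of D i D' I M] False by (auto simp: lm i_def D'_def E_def)
  qed
qed

lemma orthodontia_unique:
  "orthodontia D I M \<Longrightarrow> orthodontia D I' M' \<Longrightarrow> I' = I \<and> M' = M"
proof (induction arbitrary: I' M' rule: orthodontia.induct)
  case halt
  then show ?case by (auto elim: orthodontia.cases)
next
  case (swap D i D' I M)
  from swap.prems show ?case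
  proof (cases rule: orthodontia.cases)
    case halt
    then show ?thesis using swap.hyps(1) by blast
  next
    case (swap i' D'' I'' M'')
    have "i' = i" using swap(4) \<open>i = _\<close> by simp
    moreover from this have "D'' = D'" using swap(5) \<open>D' = _\<close> by simp
    ultimately show ?thesis using swap(1,2,6) \<open>\<And>I' M'. _ \<Longrightarrow> I' = I \<and> M' = M\<close> by blast
  qed
qed

lemma rothe_subset: "rothe n w \<subseteq> {1..n} \<times> {1..n}"
  by (auto simp: rothe_def)

lemma orthodontic_sequence_exists: "\<exists>I K M. orthodontic_sequence n w I K M"
proof -
  let ?D = "clear_columns {{1..j} | j. j \<in> {1..n}} (rothe n w)"
  have "?D \<subseteq> {1..n} \<times> {1..n}" using rothe_subset by (auto simp: clear_columns_def)
  then have "finite ?D" "\<And>j. 0 \<notin> column ?D j"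
    by (auto intro: finite_subset simp: column_def)
  moreover have "\<not> standard_interval (column ?D j)" if "column ?D j \<noteq> {}" for j
  proof
    assume "standard_interval (column ?D j)"
    then obtain k where k: "column ?D j = {1..k}" by (auto simp: standard_interval_def)
    with that have eq: "column (rothe n w) j = {1..k}" "1 \<le> k"
      by (auto simp: column_clear_columns split: if_splits)
    then have "k \<in> column (rothe n w) j" by auto
    then have "k \<le> n" using rothe_subset[of n w] by (auto simp: column_def)
    then have "column ?D j = {}" using eq by (auto simp: column_clear_columns)
    with that show False by blast
  qed
  ultimately show ?thesis
    using orthodontia_exists[of ?D] unfolding orthodontic_sequence_def by blast
qed

lemma orthodontic_sequence_unique:
  assumes "orthodontic_sequence n w I K M" "orthodontic_sequence n w I' K' M'"
  shows "I' = I \<and> K' = K \<and> M' = M"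
  using assms orthodontia_unique unfolding orthodontic_sequence_def by blast


subsection \<open>The block of rows underlying \<open>sigma\<close>\<close>

lemma primary_column_data_bij:
  assumes w: "w permutes {1..n}" and pcd: "primary_column_data n w = (h, C, \<alpha>, i\<^sub>1, \<beta>)"
  shows "\<alpha> \<le> i\<^sub>1" "\<beta> \<le> h" "bij_betw w {\<alpha> + 1..i\<^sub>1} {h - \<beta> + 1..h}"
proof -
  have "\<alpha> \<le> i\<^sub>1 \<and> \<beta> \<le> h \<and> w ` {\<alpha> + 1..i\<^sub>1} = {h - \<beta> + 1..h}"
  proof (cases "dominant n w")
    case True
    then show ?thesis
      using pcd permutes_image[OF w] by (auto simp: primary_column_data_def)
  next
    case False
    let ?std = "\<lambda>h. standard_interval (column (rothe n w) (h + 1))"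
    have hd: "h = (LEAST h. \<not> ?std h)" and Cd: "C = column (rothe n w) (h + 1)"
      and ad: "\<alpha> = (GREATEST a. {1..a} \<subseteq> C)" and i1d: "i\<^sub>1 = smallest_missing_tooth C"
      and bd: "\<beta> = i\<^sub>1 - \<alpha>"
      using pcd False by (auto simp: primary_column_data_def Let_def)
    obtain j where "j \<in> {1..n}" "\<not> standard_interval (column (rothe n w) j)"
      using False by (auto simp: dominant_def)
    then have "\<exists>h. \<not> ?std h" by (intro exI[of _ "j - 1"]) auto
    then have hn: "\<not> standard_interval C" unfolding Cd hd by (rule LeastI_ex)
    have hl: "?std k" if "k < h" for k using not_less_Least that unfolding hd by blast
    have Csub: "C \<subseteq> {1..n}" using rothe_subset unfolding Cd column_def by blast
    then have Cfin: "finite C" by (rule finite_subset) simp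
    have C0: "C \<noteq> {}" 
    proof
      assume "C = {}"
      then have "C = {1..0}" by simp
      then show False using hn unfolding standard_interval_def by blast
    qed
    have mt: "missing_tooth C i\<^sub>1"
      unfolding i1d by (rule smallest_missing_tooth) (use C0 Cfin hn Csub in auto)
    have mtl: "\<not> missing_tooth C i" if "i < i\<^sub>1" for i
      using that unfolding i1d smallest_missing_tooth_def by (rule not_less_Least)
    have bnd: "a \<le> n" if "{1..a} \<subseteq> C" for a
    proof (cases "a = 0")
      case False then have "a \<in> C" using that by auto
      then show ?thesis using Csub by auto
    qed simp
    have aC: "{1..\<alpha>} \<subseteq> C"
      unfolding ad by (rule GreatestI_nat[where k = 0 and b = n]) (use bnd in auto)
    have amax: "a \<le> \<alpha>" if "{1..a} \<subseteq> C" for a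
      unfolding ad by (rule Greatest_le_nat[where b = n]) (use bnd that in auto)
    have a1: "\<alpha> + 1 \<notin> C"
    proof
      assume "\<alpha> + 1 \<in> C"
      then have "{1..\<alpha> + 1} \<subseteq> C" using aC by (auto simp: le_Suc_eq)
      then show False using amax by fastforce
    qed
    have ai: "\<alpha> < i\<^sub>1" using mt aC by (force simp: missing_tooth_def not_less)
    have gap: "p \<notin> C" if "\<alpha> + 1 \<le> p" "p \<le> i\<^sub>1" for p
      using that
    proof (induction p rule: dec_induct)
      case base then show ?case using a1 by simp
    next
      case (step p)
      then show ?case using mtl[of p] by (auto simp: missing_tooth_def)
    qed
    have winv: "w (inv w x) = x" "inv w (w x) = x" for x
      using permutes_inverses[OF w] by auto
    have iC: "i\<^sub>1 + 1 \<in> C" using mt by (simp add: missing_tooth_def)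
    then have big: "i\<^sub>1 + 1 < inv w (h + 1)" "h + 1 < w (i\<^sub>1 + 1)" and hn': "h + 1 \<le> n" and in': "i\<^sub>1 + 1 \<le> n"
      by (auto simp: Cd column_def rothe_def)
    have Cmem: "p \<in> C \<longleftrightarrow> h + 1 < w p" if "1 \<le> p" "p \<le> i\<^sub>1" for p
      using that big hn' in' by (auto simp: Cd column_def rothe_def)
    have low: "w p \<in> {1..h}" if "p \<in> {\<alpha> + 1..i\<^sub>1}" for p
    proof -
      have p: "p \<in> {1..n}" using that in' by auto
      then have "w p \<in> {1..n}" using permutes_in_image[OF w] by blast
      moreover have "w p \<noteq> h + 1" using big that winv(2)[of p] by auto
      ultimately show ?thesis using Cmem[of p] gap[of p] that by auto
    qed
    have top: "c < w p" if c: "c \<in> {1..h}" "c \<notin> w ` {\<alpha> + 1..i\<^sub>1}" and p: "p \<in> {\<alpha> + 1..i\<^sub>1}" for c p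
    proof -
      have cn: "c \<in> {1..n}" using c hn' by auto
      have q: "inv w c \<in> {1..n}" using permutes_in_image[OF permutes_inv[OF w]] cn by blast
      have "inv w c \<notin> {\<alpha> + 1..i\<^sub>1}" using c(2) winv(1)[of c] by (metis imageI)
      moreover have "\<not> inv w c \<le> \<alpha>"
      proof
        assume le: "inv w c \<le> \<alpha>"
        then have "inv w c \<in> C" using aC q by auto
        then show False using Cmem[of "inv w c"] q le ai c winv(1)[of c] by auto
      qed
      moreover have "inv w c \<noteq> i\<^sub>1 + 1" using big(2) c winv(1)[of c] by auto
      ultimately have "i\<^sub>1 + 1 < inv w c" by auto
      then have mem: "i\<^sub>1 + 1 \<in> column (rothe n w) c"
        using big(2) c cn in' by (auto simp: column_def rothe_def)
      have "standard_interval (column (rothe n w) c)" using hl[of "c - 1"] c by auto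
      then obtain t where "column (rothe n w) c = {1..t}" by (auto simp: standard_interval_def)
      then have "p \<in> column (rothe n w) c" using mem p by auto
      then show ?thesis by (auto simp: column_def rothe_def)
    qed
    let ?S = "w ` {\<alpha> + 1..i\<^sub>1}"
    have S: "?S \<subseteq> {1..h}" using low by blast
    have cS: "card ?S = \<beta>"
      using permutes_inj_on[OF w] by (subst card_image) (auto simp: bd)
    then have bh: "\<beta> \<le> h" using card_mono[OF _ S] by simp
    define m where "m = Min ?S"
    have Sne: "?S \<noteq> {}" using ai by auto
    have mS: "m \<in> ?S" unfolding m_def using Sne by (intro Min_in) auto
    have "?S = {m..h}"
    proof
      show "?S \<subseteq> {m..h}" using S by (auto simp: m_def)
      show "{m..h} \<subseteq> ?S"
      proof
        fix c assume c: "c \<in> {m..h}"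
        show "c \<in> ?S"
        proof (rule ccontr)
          assume "c \<notin> ?S"
          moreover have "c \<in> {1..h}" using c mS S by auto
          ultimately have "c < m" using top mS by blast
          then show False using c by auto
        qed
      qed
    qed
    moreover have "1 \<le> m" using mS S by auto
    moreover have "m = h - \<beta> + 1" using cS mS calculation by auto
    ultimately show ?thesis using bh ai by simp
  qed
  then show "\<alpha> \<le> i\<^sub>1" "\<beta> \<le> h" "bij_betw w {\<alpha> + 1..i\<^sub>1} {h - \<beta> + 1..h}"
    using permutes_inj_on[OF w] by (auto simp: bij_betw_def)
qed

end

theory Submission
  imports Defs
begin

text \<open>
  Write \<open>i\<^sub>1 = \<alpha> + \<beta>\<close> and \<open>h = g + \<beta>\<close>. Sortedness means that \<open>w (\<alpha> + p) = g + p\<close> for \<open>1 \<le> p \<le> \<beta>\<close>, and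
  this splits the columns of \<open>D(w)\<close> into three blocks: columns \<open>1, \<dots>, g\<close> are standard intervals
  containing \<open>[i\<^sub>1 + 1]\<close>, columns \<open>g + 1, \<dots>, h\<close> equal \<open>[\<alpha>]\<close>, and columns beyond \<open>h\<close> avoid the rows
  \<open>[\<alpha> + 1, i\<^sub>1]\<close>. On the columns of the third kind the first \<open>\<beta>\<close> orthodontic swaps move a cell in row
  \<open>i\<^sub>1 + 1\<close> up to row \<open>\<alpha> + 1\<close> through empty rows, so no column can become a standard interval before
  the last of them. Passing from \<open>w\<close> to \<open>w s\<^bsub>i\<^sub>1\<^esub> \<cdots> s\<^bsub>\<alpha>+1\<^esub>\<close> moves the same cells in the same way, fixes
  the first block and turns the \<open>\<beta>\<close> columns of the second one from \<open>[\<alpha>]\<close> into \<open>[\<alpha> + 1]\<close>.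
\<close>

section \<open>Missing teeth and gaps of empty rows in a column\<close>

lemma diagram_eqI: "(\<And>j. column D j = column E j) \<Longrightarrow> D = E"
  unfolding column_def by auto

lemma smallest_missing_tooth_eqI:
  assumes "a < i" "{1..a} \<subseteq> S" "S \<inter> {a + 1..i} = {}" "i + 1 \<in> S"
  shows "smallest_missing_tooth S = i"
  unfolding smallest_missing_tooth_def
proof (rule Least_equality)
  show "missing_tooth S i"
    using assms by (auto simp: missing_tooth_def)
next
  fix k assume k: "missing_tooth S k"
  show "i \<le> k"
  proof (rule ccontr)
    assume "\<not> i \<le> k"
    moreover have "a < k" using k assms(2) by (force simp: missing_tooth_def not_less)
    ultimately have "k + 1 \<in> {a + 1..i}" by simp
    then show False using k assms(3) by (auto simp: missing_tooth_def)
  qed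
qed

text \<open>Net effect of the swaps at \<open>i\<close>, \<open>i - 1\<close>, ...,
  \<open>a + 1\<close> on a column whose rows \<open>a + 1\<close>, ..., \<open>i\<close> are empty;
  only for such columns does the formula have this meaning.\<close>

definition slide :: "nat \<Rightarrow> nat \<Rightarrow> nat set \<Rightarrow> nat set" where
  "slide a i S = (if i + 1 \<in> S then insert (a + 1) (S - {i + 1}) else S)"

lemma slide_empty [simp]: "slide a i {} = {}"
  by (simp add: slide_def)

lemma slide_empty_iff [simp]: "slide a i S = {} \<longleftrightarrow> S = {}"
  by (auto simp: slide_def)

lemma transpose_image_eq_slide:
  assumes "i \<notin> S" "0 < i"
  shows "transpose i (i + 1) ` S = slide (i - 1) i S"
  using assms by (auto simp: slide_def transpose_def image_iff)

lemma slide_slide: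
  assumes "a < i" "S \<inter> {a + 1..i + 1} = {}"
  shows "slide a i (slide i (i + 1) S) = slide a (i + 1) S"
  using assms by (auto simp: slide_def)

lemma standard_avoiding_le:
  fixes a i k :: nat
  assumes "a < i" "{1..k} \<inter> {a + 1..i} = {}"
  shows "k \<le> a"
proof (rule ccontr)
  assume "\<not> k \<le> a"
  then have "a + 1 \<in> {1..k} \<inter> {a + 1..i}" using assms(1) by simp
  then show False using assms(2) by blast
qed

lemma slide_standard:
  assumes "k \<le> a" "a < i"
  shows "slide a i {1..k} = {1..k}"
  using assms by (auto simp: slide_def)

text \<open>If a cell moves, the result contains \<open>a + 1\<close> but not \<open>a + 2\<close>,
  which lies in the gap or is the vacated row \<open>i + 1\<close>. Hence \<open>{1..a + 1}\<close>
  is the only standard interval that a slide can create.\<close>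

lemma slide_eq_standard_iff:
  assumes "a < i" "S \<inter> {a + 1..i} = {}" "k \<noteq> a + 1"
  shows "slide a i S = {1..k} \<longleftrightarrow> S = {1..k}"
proof
  assume eq: "slide a i S = {1..k}"
  show "S = {1..k}"
  proof (cases "i + 1 \<in> S")
    case True
    then have ins: "insert (a + 1) (S - {i + 1}) = {1..k}" using eq by (simp add: slide_def)
    then have "a + 1 \<in> {1..k}" "i + 1 \<notin> {1..k}"
      using assms(1) by (blast, metis DiffE add_right_cancel insert_iff less_irrefl singletonI)
    then have k: "a + 2 \<le> k" "k \<le> i" using assms(3) by auto
    then have "a + 2 \<in> insert (a + 1) (S - {i + 1})" unfolding ins by simp
    then have "a + 2 \<in> S \<inter> {a + 1..i}" using k by auto
    then show ?thesis using assms(2) by blast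
  qed (use eq in \<open>simp add: slide_def\<close>)
next
  assume "S = {1..k}"
  then show "slide a i S = {1..k}"
    using slide_standard[of k a i] standard_avoiding_le[of a i k] assms by simp
qed

section \<open>Orthodontic swaps through a gap\<close>

text \<open>Each swap shortens the gap by one row and keeps \<open>{1..a}\<close> and the cell below
  the gap in the leftmost column, which forces the next swap. Before the last swap row
  \<open>a + 1\<close> is empty in every column, so no column can equal the interval being counted:
  the counts are 0 and nothing is cleared. \<open>D'\<close> is the diagram after the last swap,
  before clearing.\<close>

lemma orthodontia_slide:
  assumes "orthodontia D I M" "a < i"
    and "\<And>j. column D j \<inter> {a + 1..i} = {}"
    and "{1..a} \<subseteq> leftmost_column D" "i + 1 \<in> leftmost_column D"
  shows "\<exists>I' M' D'. I = rev [a + 1..<i + 1] @ I'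
    \<and> M = replicate (i - a - 1) 0 @ count_columns {1..a + 1} D' # M'
    \<and> (\<forall>j. column D' j = slide a i (column D j))
    \<and> orthodontia (clear_columns {{1..a + 1}} D') I' M'"
  using assms
proof (induction "i - a - 1" arbitrary: i D I M)
  case 0
  then have i: "i = a + 1" by simp
  have smt: "smallest_missing_tooth (leftmost_column D) = i"
    using 0 by (intro smallest_missing_tooth_eqI[of a]) (auto simp: leftmost_column_def)
  have col: "column (swap_rows i D) j = slide a i (column D j)" for j
    unfolding column_swap_rows using transpose_image_eq_slide[of i "column D j"] 0(4)[of j] i
    by auto
  have ne: "D \<noteq> {}" using 0(6) by (auto simp: leftmost_column_def column_def)
  from 0(2) ne obtain I' M' where "I = i # I'" "M = count_columns {1..i} (swap_rows i D) # M'"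
    "orthodontia (clear_columns {{1..i}} (swap_rows i D)) I' M'"
    by (cases rule: orthodontia.cases) (auto simp: smt)
  then show ?case using i col
    by (intro exI[of _ I'] exI[of _ M'] exI[of _ "swap_rows i D"]) simp
next
  case (Suc d)
  define i' where "i' = i - 1"
  have i: "i = i' + 1" and ai: "a < i'" and d: "d = i' - a - 1" using Suc(2) by (auto simp: i'_def)
  define D' where "D' = swap_rows i D"
  have smt: "smallest_missing_tooth (leftmost_column D) = i"
    using Suc(4-) by (intro smallest_missing_tooth_eqI[of a]) (auto simp: leftmost_column_def)
  have col: "column D' j = slide i' i (column D j)" for j
  proof -
    have "i \<notin> column D j" using Suc(4) Suc(5)[of j] by auto
    then show ?thesis
      unfolding D'_def column_swap_rows using transpose_image_eq_slide[of i] i by simp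
  qed
  have notin: "a + 1 \<notin> column D' j" for j
    using Suc(5)[of j] ai i unfolding col slide_def by auto
  have nocol: "column D' j \<noteq> {1..i}" for j
    using notin[of j] ai i by auto
  have cnt: "count_columns {1..i} D' = 0" using nocol by (simp add: count_columns_def)
  have clr: "clear_columns {{1..i}} D' = D'"
    using nocol by (auto simp: clear_columns_def)
  have ne: "D \<noteq> {}" using Suc(7) by (auto simp: leftmost_column_def column_def)
  from Suc(3) ne obtain I1 M1 where 1: "I = i # I1" "M = 0 # M1" "orthodontia D' I1 M1"
    by (cases rule: orthodontia.cases) (auto simp: smt clr[simplified] cnt[simplified] simp flip: D'_def)
  \<comment> \<open>A slide preserves emptiness in both directions, so the leftmost nonempty column
    keeps its index.\<close>
  have lm: "leftmost_column D' = slide i' i (leftmost_column D)"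
    by (simp add: leftmost_column_def col)
  have dis: "column D' j \<inter> {a + 1..i'} = {}" for j
    using Suc(5)[of j] unfolding col slide_def i by auto
  have "{1..a} \<subseteq> leftmost_column D'" "i' + 1 \<in> leftmost_column D'"
    using Suc(6,7) ai unfolding lm slide_def i by auto
  from Suc(1)[OF d 1(3) ai dis this] obtain I' M' E where E:
    "I1 = rev [a + 1..<i' + 1] @ I'"
    "M1 = replicate (i' - a - 1) 0 @ count_columns {1..a + 1} E # M'"
    "\<And>j. column E j = slide a i' (column D' j)"
    "orthodontia (clear_columns {{1..a + 1}} E) I' M'"
    by blast
  have "column E j = slide a i (column D j)" for j
    unfolding E(3) col i using slide_slide[OF ai] Suc(5)[of j] i by simp
  moreover have "I = rev [a + 1..<i + 1] @ I'" using 1 E ai i by simp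
  moreover have "M = replicate (i - a - 1) 0 @ count_columns {1..a + 1} E # M'"
    using 1 E ai i by (simp add: Suc_diff_Suc flip: replicate_Suc)
  ultimately show ?case using E(4) by blast
qed

section \<open>The word of transpositions as a cycle of positions\<close>

text \<open>The composite of the transpositions at \<open>i\<close>, ..., \<open>a + 1\<close>.
  Precomposing with it brings the entry in position \<open>i + 1\<close> to position
  \<open>a + 1\<close> and pushes those in \<open>a + 1\<close>, ..., \<open>i\<close> one position
  on.\<close>

definition row_cycle :: "nat \<Rightarrow> nat \<Rightarrow> nat \<Rightarrow> nat" where
  "row_cycle a i r = (if r = a + 1 then i + 1 else if r \<in> {a + 2..i + 1} then r - 1 else r)"

lemma right_mult_word_eq_row_cycle:
  "a \<le> i \<Longrightarrow> right_mult_word w (rev [a + 1..<i + 1]) = w \<circ> row_cycle a i"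
proof (induction i arbitrary: w rule: dec_induct)
  case base
  have "row_cycle a a = id" by (auto simp: row_cycle_def fun_eq_iff)
  then show ?case by (simp add: right_mult_word_def)
next
  case (step i)
  \<comment> \<open>The reversed word starts with its largest letter, which \<open>foldl\<close>
    absorbs into \<open>w\<close>; hence the induction over arbitrary \<open>w\<close>.\<close>
  have "right_mult_word w (rev [a + 1..<Suc i + 1])
      = right_mult_word (w \<circ> transpose (i + 1) (i + 2)) (rev [a + 1..<i + 1])"
    using step by (simp add: right_mult_word_def)
  also have "\<dots> = w \<circ> transpose (i + 1) (i + 2) \<circ> row_cycle a i" by (rule step.IH)
  also have "\<dots> = w \<circ> row_cycle a (Suc i)"
    using step(1) by (intro ext) (auto simp: row_cycle_def transpose_def le_Suc_eq)
  finally show ?case .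
qed

lemma inj_row_cycle: "a \<le> i \<Longrightarrow> inj (row_cycle a i)"
  by (auto simp: inj_def row_cycle_def split: if_splits)

section \<open>Rothe diagrams and the block of sorted rows\<close>

text \<open>The bound \<open>n\<close> on the cleared intervals loses nothing, because rows of a
  Rothe diagram are at most \<open>n\<close>; the empty column is standard and stays empty.\<close>

lemma column_clear_standard:
  "column (clear_columns {{1..j} | j. j \<in> {1..n}} (rothe n w)) c =
    (if standard_interval (column (rothe n w) c) then {} else column (rothe n w) c)"
proof -
  have "k \<in> {1..n}" if "column (rothe n w) c = {1..k}" "k \<noteq> 0" for k
  proof -
    have "k \<in> column (rothe n w) c" using that by simp
    then show ?thesis by (auto simp: column_def rothe_def)
  qed
  then have iff: "column (rothe n w) c \<in> {{1..j} | j. j \<in> {1..n}} \<longleftrightarrow>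
      standard_interval (column (rothe n w) c)" if "column (rothe n w) c \<noteq> {}"
    using that unfolding standard_interval_def by auto
  show ?thesis
  proof (cases "column (rothe n w) c = {}")
    case False
    show ?thesis unfolding column_clear_columns iff[OF False] ..
  qed (simp add: column_clear_columns)
qed

text \<open>All columns outside \<open>{1..n}\<close> are empty, so the index set is infinite for
  \<open>S = {}\<close>. Finiteness is needed to add cardinalities below.\<close>

lemma finite_columns_rothe: "S \<noteq> {} \<Longrightarrow> finite {j. column (rothe n w) j = S}"
  by (rule finite_subset[of _ "{1..n}"]) (auto simp: column_def rothe_def)

text \<open>Here \<open>i\<^sub>1 = a + b\<close> and \<open>h = g + b\<close>, which keeps truncated subtraction out of the statements.\<close>

locale sorted_block =
  fixes n :: nat and w :: "nat \<Rightarrow> nat" and g a b :: nat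
  assumes perm: "w permutes {1..n}"
    and b_pos: "0 < b" and row_bound: "a + b + 1 \<le> n"
    and block: "\<And>p. p \<in> {1..b} \<Longrightarrow> w (a + p) = g + p"
    and above: "\<And>r. r \<in> {1..a} \<Longrightarrow> g + b + 1 < w r"
    and below: "g + b + 1 < w (a + b + 1)"
    and pos: "a + b + 1 < inv w (g + b + 1)"
    and std: "\<And>j. j \<in> {1..g + b} \<Longrightarrow> standard_interval (column (rothe n w) j)"
begin

definition v :: "nat \<Rightarrow> nat" where "v = w \<circ> row_cycle a (a + b)"

abbreviation wcol :: "nat \<Rightarrow> nat set" where "wcol \<equiv> column (rothe n w)"
abbreviation vcol :: "nat \<Rightarrow> nat set" where "vcol \<equiv> column (rothe n v)"

lemma w_inv [simp]: "w (inv w x) = x" "inv w (w x) = x"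
  using permutes_inverses[OF perm] by auto

lemma col_bound: "g + b + 1 < n"
proof -
  have "w (a + b + 1) \<in> {1..n}"
    using permutes_in_image[OF perm] row_bound by simp
  then show ?thesis using below by simp
qed

lemma w_block: "r \<in> {a + 1..a + b} \<Longrightarrow> w r + a = g + r"
  using block[of "r - a"] by (auto simp: le_diff_conv)

lemma inv_w_range: "j \<in> {1..n} \<Longrightarrow> inv w j \<in> {1..n}"
  using permutes_in_image[OF permutes_inv[OF perm]] by blast

lemma wcol_iff: "r \<in> wcol j \<longleftrightarrow> r \<in> {1..n} \<and> j \<in> {1..n} \<and> r < inv w j \<and> j < w r"
  by (simp add: column_def rothe_def)

lemma vcol_iff: "r \<in> vcol j \<longleftrightarrow> r \<in> {1..n} \<and> j \<in> {1..n} \<and> r < inv v j \<and> j < v r"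
  by (simp add: column_def rothe_def)

lemma v_simps:
  "v (Suc a) = w (a + b + 1)"
  "r \<in> {a + 2..a + b + 1} \<Longrightarrow> v r = w (r - 1)"
  "r \<notin> {a + 1..a + b + 1} \<Longrightarrow> v r = w r"
  by (auto simp: v_def row_cycle_def)

lemma inv_v:
  "inv v j = (if inv w j = a + b + 1 then a + 1
     else if inv w j \<in> {a + 1..a + b} then inv w j + 1 else inv w j)"
proof (rule inv_f_eq)
  show "inj v" unfolding v_def
    using permutes_inj[OF perm] inj_row_cycle by (intro inj_compose) auto
  have "w (inv w j) = j" by simp
  then show "v (if inv w j = a + b + 1 then a + 1
     else if inv w j \<in> {a + 1..a + b} then inv w j + 1 else inv w j) = j"
    by (cases "inv w j = a + b + 1") (auto simp: v_def row_cycle_def simp del: w_inv)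
qed

lemma inv_w_mid: "j \<in> {g + 1..g + b} \<Longrightarrow> inv w j + g = a + j"
  using block[of "j - g"] w_inv(2)[of "a + (j - g)"] by (auto simp: le_diff_conv simp del: w_inv)

text \<open>Rows up to \<open>a\<close> and row \<open>a + b + 1\<close> carry values above
  \<open>g + b + 1\<close>, and the block carries only \<open>g + 1\<close>, ...,
  \<open>g + b\<close>, so a value at most \<open>g\<close> must sit further down.\<close>

lemma inv_w_low:
  assumes "j \<in> {1..g}"
  shows "a + b + 1 < inv w j"
proof -
  have "inv w j \<in> {1..n}" using inv_w_range assms col_bound by auto
  moreover have "inv w j \<notin> {1..a}" using above[of "inv w j"] assms by auto
  moreover have "inv w j \<notin> {a + 1..a + b}" using w_block[of "inv w j"] assms by auto
  moreover have "inv w j \<noteq> a + b + 1" using below assms w_inv(1)[of j] by fastforce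
  ultimately show ?thesis by auto
qed

lemma inv_w_high: "g + b < j \<Longrightarrow> inv w j \<notin> {a + 1..a + b}"
  using w_block[of "inv w j"] by auto

section \<open>The three blocks of columns for \<open>w\<close> and \<open>v\<close>\<close>

lemma wcol_low:
  assumes "j \<in> {1..g}"
  obtains t where "a + b + 1 \<le> t" "wcol j = {1..t}"
proof -
  obtain t where t: "wcol j = {1..t}"
    using std[of j] assms by (auto simp: standard_interval_def)
  have "a + b + 1 \<in> wcol j"
    using inv_w_low[OF assms] below assms col_bound row_bound by (auto simp: wcol_iff)
  then show ?thesis using that t by simp
qed

lemma wcol_mid:
  assumes "j \<in> {g + 1..g + b}"
  shows "wcol j = {1..a}"
proof (rule set_eqI)
  fix r
  have "j < w r" if "1 \<le> r" "r \<le> a" using above[of r] that assms by simp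
  \<comment> \<open>Sortedness enters here: block rows above the one holding \<open>j\<close> carry
    values smaller than \<open>j\<close>.\<close>
  moreover have "\<not> j < w r" if "a < r" "r < inv w j"
    using w_block[of r] inv_w_mid[OF assms] that assms by auto
  ultimately show "r \<in> wcol j \<longleftrightarrow> r \<in> {1..a}"
    using inv_w_mid[OF assms] assms col_bound row_bound by (auto simp: wcol_iff not_le[symmetric])
qed

lemma wcol_high: "g + b < j \<Longrightarrow> wcol j \<inter> {a + 1..a + b} = {}"
  using w_block by (fastforce simp: wcol_iff)

lemma wcol_zero: "wcol 0 = {}" and vcol_zero: "vcol 0 = {}"
  by (auto simp: wcol_iff vcol_iff)

text \<open>The cycle only rearranges rows \<open>a + 1\<close>, ..., \<open>a + b + 1\<close>; all
  their values exceed \<open>j\<close>, and \<open>j\<close> itself sits below them.\<close>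

lemma vcol_low:
  assumes "j \<in> {1..g}"
  shows "vcol j = wcol j"
proof (rule set_eqI)
  fix r
  obtain t where t: "a + b + 1 \<le> t" "wcol j = {1..t}" using wcol_low[OF assms] .
  have gt: "j < w q" if "1 \<le> q" "q \<le> a + b + 1" for q
  proof -
    have "q \<in> wcol j" using t that by simp
    then show ?thesis by (simp add: wcol_iff)
  qed
  have inv: "inv v j = inv w j" using inv_w_low[OF assms] by (simp add: inv_v)
  have "j < v r \<longleftrightarrow> j < w r" if "1 \<le> r"
  proof (cases "r \<in> {a + 1..a + b + 1}")
    case True
    then have "j < w r" using gt that by auto
    moreover have "v r = w (if r = a + 1 then a + b + 1 else r - 1)"
      using True v_simps(1) v_simps(2)[of r] by auto
    then have "j < v r" using True by (auto intro!: gt)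
    ultimately show ?thesis by simp
  qed (simp add: v_simps)
  then show "r \<in> vcol j \<longleftrightarrow> r \<in> wcol j" by (auto simp: vcol_iff wcol_iff inv)
qed

text \<open>Row \<open>a + 1\<close> receives the large entry of row \<open>a + b + 1\<close>, and
  each block value moves down one row; this adds exactly the cell in row
  \<open>a + 1\<close>.\<close>

lemma vcol_mid:
  assumes "j \<in> {g + 1..g + b}"
  shows "vcol j = {1..a + 1}"
proof (rule set_eqI)
  fix r
  have inv: "inv v j + g = a + j + 1" using inv_w_mid[OF assms] assms by (auto simp: inv_v)
  have "j < v r" if "1 \<le> r" "r \<le> a" using above[of r] that assms by (simp add: v_simps)
  moreover have "j < v (a + 1)" using below assms by (simp add: v_simps)
  moreover have "\<not> j < v r" if "a + 1 < r" "r < inv v j"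
  proof -
    have "r - 1 \<in> {a + 1..a + b}" "r \<in> {a + 2..a + b + 1}" using inv that assms by auto
    then show ?thesis using w_block[of "r - 1"] v_simps(2)[of r] inv that by auto
  qed
  ultimately show "r \<in> vcol j \<longleftrightarrow> r \<in> {1..a + 1}"
    using inv assms col_bound row_bound
    by (cases "r = a + 1") (auto simp: vcol_iff not_le[symmetric])
qed

lemma vcol_high:
  assumes "g + b < j"
  shows "vcol j = slide a (a + b) (wcol j)"
proof (rule set_eqI)
  fix r
  have inv: "inv v j = (if inv w j = a + b + 1 then a + 1 else inv w j)"
    and niv: "inv w j \<notin> {a + 1..a + b}"
    using inv_w_high[OF assms] by (auto simp: inv_v)
  have dis: "q \<notin> wcol j" if "q \<in> {a + 1..a + b}" for q using wcol_high[OF assms] that by blast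
  consider "r = a + 1" | "r \<in> {a + 2..a + b + 1}" | "r \<notin> {a + 1..a + b + 1}" by fastforce
  then show "r \<in> vcol j \<longleftrightarrow> r \<in> slide a (a + b) (wcol j)"
  proof cases
    case 1
    \<comment> \<open>Since \<open>j\<close> is not a block value, its position exceeds
      \<open>a + 1\<close> in \<open>v\<close> exactly when it exceeds \<open>a + b + 1\<close> in
      \<open>w\<close>.\<close>
    then have "r \<in> vcol j \<longleftrightarrow> a + b + 1 \<in> wcol j"
      using niv row_bound by (auto simp: vcol_iff wcol_iff inv v_simps)
    then show ?thesis using 1 dis[of "a + 1"] b_pos by (auto simp: slide_def)
  next
    case 2
    then have "r - 1 \<in> {a + 1..a + b}" "v r = w (r - 1)" by (auto simp: v_simps)
    then have "v r \<le> g + b" using w_block[of "r - 1"] by auto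
    then have "r \<notin> vcol j" using assms by (simp add: vcol_iff)
    then show ?thesis using 2 dis[of r] by (cases "r = a + b + 1") (auto simp: slide_def)
  next
    case 3
    then have "r \<in> vcol j \<longleftrightarrow> r \<in> wcol j"
      using niv by (auto simp: vcol_iff wcol_iff inv v_simps)
    then show ?thesis using 3 by (auto simp: slide_def)
  qed
qed

lemma column_cases:
  obtains "j = 0" | "j \<in> {1..g}" | "j \<in> {g + 1..g + b}" | "g + b < j"
  by fastforce

text \<open>Low columns contain \<open>{1..a + b + 1}\<close>, middle ones equal
  \<open>{1..a}\<close>, high ones miss row \<open>a + 1\<close>. This gives the vanishing of
  \<open>k_j\<close> on the gap.\<close>

lemma wcol_ne_standard: "k \<in> {a + 1..a + b} \<Longrightarrow> wcol j \<noteq> {1..k}"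
proof
  assume k: "k \<in> {a + 1..a + b}" and eq: "wcol j = {1..k}"
  show False
  proof (cases rule: column_cases[of j])
    case 2
    then show ?thesis using wcol_low[OF 2] eq k by (auto simp: Icc_eq_Icc)
  next
    case 4
    then show ?thesis using standard_avoiding_le[of a "a + b" k] wcol_high[OF 4] eq k b_pos by auto
  qed (use eq k wcol_mid[of j] wcol_zero in \<open>auto simp: Icc_eq_Icc\<close>)
qed

section \<open>Starting diagrams of the two orthodontic runs\<close>

definition wstart :: diagram where
  "wstart = clear_columns {{1..j} | j. j \<in> {1..n}} (rothe n w)"
definition vstart :: diagram where
  "vstart = clear_columns {{1..j} | j. j \<in> {1..n}} (rothe n v)"

lemma standard_wcol: "j \<le> g + b \<Longrightarrow> standard_interval (wcol j)"
proof (cases "j = 0")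
  case True
  then have "wcol j = {1..0}" using wcol_zero by simp
  then show ?thesis unfolding standard_interval_def by blast
qed (simp add: std)

lemma column_wstart:
  "column wstart j = (if standard_interval (wcol j) then {} else wcol j)"
  unfolding wstart_def by (rule column_clear_standard)

lemma column_vstart:
  "column vstart j = (if standard_interval (vcol j) then {} else vcol j)"
  unfolding vstart_def by (rule column_clear_standard)

lemma column_wstart_disjoint: "column wstart j \<inter> {a + 1..a + b} = {}"
  using standard_wcol[of j] wcol_high[of j] by (cases "j \<le> g + b") (auto simp: column_wstart)

text \<open>Low and middle columns are empty on both sides. A standard high column is fixed by the
  slide, hence cleared for both permutations. Any other high column can become standard only as
  \<open>{1..a + 1}\<close>, which is just what the clearing after the last swap removes.\<close>

lemma vstart_eqI:
  assumes D': "\<And>j. column D' j = slide a (a + b) (column wstart j)"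
  shows "clear_columns {{1..a + 1}} D' = vstart"
proof (rule diagram_eqI)
  fix j
  show "column (clear_columns {{1..a + 1}} D') j = column vstart j"
  proof (cases "j \<le> g + b")
    case True
    have "standard_interval (vcol j)"
      using True standard_wcol[of j] vcol_low vcol_mid vcol_zero wcol_zero
      by (cases rule: column_cases[of j]) (auto simp: standard_interval_def)
    then show ?thesis
      using standard_wcol[OF True] D'
      by (simp add: column_clear_columns column_wstart column_vstart)
  next
    case False
    then have high: "g + b < j" by simp
    note dis = wcol_high[OF high]
    have ab: "a < a + b" using b_pos by simp
    have sl: "slide a (a + b) (wcol j) = {1..k} \<longleftrightarrow> wcol j = {1..k}" if "k \<noteq> a + 1" for k
      by (rule slide_eq_standard_iff) (use that dis ab in auto)
    show ?thesis
    proof (cases "standard_interval (wcol j)")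
      case True
      then obtain k where k: "wcol j = {1..k}" by (auto simp: standard_interval_def)
      have "k \<noteq> a + 1" using wcol_ne_standard[of k j] k b_pos by auto
      then have "standard_interval (vcol j)"
        using sl k vcol_high[OF high] by (auto simp: standard_interval_def)
      then show ?thesis using True D'
        by (simp add: column_clear_columns column_wstart column_vstart)
    next
      case False
      then have "standard_interval (vcol j) \<longleftrightarrow> vcol j = {1..a + 1}"
        using sl vcol_high[OF high] unfolding standard_interval_def by metis
      then show ?thesis using False D' vcol_high[OF high]
        by (simp add: column_clear_columns column_wstart column_vstart)
    qed
  qed
qed

section \<open>Multiplicities of standard columns\<close>

lemma vcol_eq_standard_iff:
  assumes "k \<noteq> a + 1" "k \<noteq> a"
  shows "vcol j = {1..k} \<longleftrightarrow> wcol j = {1..k}"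
proof (cases rule: column_cases[of j])
  case 3
  then show ?thesis using assms by (auto simp: vcol_mid wcol_mid Icc_eq_Icc)
next
  case 4
  then show ?thesis
    using slide_eq_standard_iff[of a "a + b" "wcol j" k] wcol_high[OF 4] assms b_pos
    by (simp add: vcol_high)
qed (simp_all add: vcol_low wcol_zero vcol_zero)

lemma count_other:
  "k \<noteq> a \<Longrightarrow> k \<noteq> a + 1 \<Longrightarrow> count_columns {1..k} (rothe n v) = count_columns {1..k} (rothe n w)"
  using vcol_eq_standard_iff[of k] by (simp add: count_columns_def)

text \<open>Only the \<open>b\<close> middle columns lose the value \<open>{1..a}\<close>. For
  \<open>a = 0\<close> that value is the empty set, which occurs infinitely often and has count
  0.\<close>

lemma count_a:
  assumes "0 < a"
  shows "count_columns {1..a} (rothe n w) = count_columns {1..a} (rothe n v) + b"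
proof -
  have "wcol j = {1..a} \<longleftrightarrow> vcol j = {1..a} \<or> j \<in> {g + 1..g + b}" for j
  proof (cases rule: column_cases[of j])
    case 4
    then show ?thesis
      using slide_eq_standard_iff[of a "a + b" "wcol j" a] wcol_high[OF 4] b_pos
      by (auto simp: vcol_high)
  qed (use assms in \<open>auto simp: wcol_mid vcol_low wcol_zero vcol_zero\<close>)
  then have "{j. wcol j = {1..a}} = {j. vcol j = {1..a}} \<union> {g + 1..g + b}" by auto
  moreover have "{j. vcol j = {1..a}} \<inter> {g + 1..g + b} = {}"
    using vcol_mid by (auto simp: Icc_eq_Icc)
  moreover have "finite {j. vcol j = {1..a}}" using assms by (intro finite_columns_rothe) auto
  ultimately show ?thesis by (simp add: count_columns_def card_Un_disjoint)
qed

text \<open>Besides the middle columns, those equal to \<open>{1..a + 1}\<close> for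
  \<open>v\<close> are the high columns that the swaps turn into this interval, which
  \<open>D'\<close> records. Standard high columns do not contribute: they lie within
  \<open>{1..a}\<close> and do not move.\<close>

lemma count_Suc_a:
  assumes D': "\<And>j. column D' j = slide a (a + b) (column wstart j)"
  shows "count_columns {1..a + 1} (rothe n v) = b + count_columns {1..a + 1} D'"
proof -
  let ?T = "{1..a + 1}"
  have "vcol j = ?T \<longleftrightarrow> j \<in> {g + 1..g + b} \<or> column D' j = ?T" for j
  proof (cases rule: column_cases[of j])
    case 1
    then show ?thesis using standard_wcol[of j] by (simp add: vcol_zero D' column_wstart)
  next
    case 2
    then show ?thesis using standard_wcol[of j] wcol_ne_standard[of "a + 1" j] b_pos
      by (simp add: vcol_low D' column_wstart)
  next
    case 3
    then show ?thesis using vcol_mid by simp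
  next
    case 4
    have "slide a (a + b) (wcol j) \<noteq> ?T" if std: "standard_interval (wcol j)"
    proof -
      obtain k where k: "wcol j = {1..k}" using std by (auto simp: standard_interval_def)
      then have "k \<le> a" using standard_avoiding_le[of a "a + b" k] wcol_high[OF 4] b_pos by simp
      then show ?thesis using k slide_standard[of k a "a + b"] b_pos by (simp add: Icc_eq_Icc)
    qed
    then show ?thesis using 4 by (auto simp: vcol_high D' column_wstart)
  qed
  then have eq: "{j. vcol j = ?T} = {g + 1..g + b} \<union> {j. column D' j = ?T}" by auto
  moreover have "{g + 1..g + b} \<inter> {j. column D' j = ?T} = {}"
    using standard_wcol by (auto simp: D' column_wstart)
  moreover have "finite {j. vcol j = ?T}" by (intro finite_columns_rothe) auto
  ultimately show ?thesis by (simp add: count_columns_def card_Un_disjoint)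
qed

section \<open>The first swaps and the remaining run\<close>

lemma leftmost_column_wstart:
  assumes "\<not> standard_interval (wcol (g + b + 1))"
  shows "leftmost_column wstart = wcol (g + b + 1)"
proof -
  have ne: "wcol (g + b + 1) \<noteq> {}"
    using assms unfolding standard_interval_def by (metis atLeastatMost_empty_iff not_one_le_zero)
  have "(LEAST j. column wstart j \<noteq> {}) = g + b + 1"
    using assms ne standard_wcol
    by (intro Least_equality) (auto simp: column_wstart not_less_eq_eq split: if_splits)
  then show ?thesis using assms by (simp add: leftmost_column_def column_wstart)
qed

lemma wcol_primary: "{1..a} \<subseteq> wcol (g + b + 1)" "a + b + 1 \<in> wcol (g + b + 1)"
  using above below pos row_bound col_bound by (auto simp: wcol_iff)

lemma not_standard_primary: "\<not> standard_interval (wcol (g + b + 1))"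
proof
  assume "standard_interval (wcol (g + b + 1))"
  then obtain t where "wcol (g + b + 1) = {1..t}" by (auto simp: standard_interval_def)
  then have "a + 1 \<in> wcol (g + b + 1)" using wcol_primary(2) by simp
  then show False using wcol_high[of "g + b + 1"] b_pos by auto
qed

text \<open>The first \<open>b\<close> swaps are one slide through the gap, and \<open>m\<close> is
  the count after the last of them. What remains is a run on the starting diagram of
  \<open>v\<close>.\<close>

lemma orthodontic_sequence_block:
  assumes "orthodontic_sequence n w I K M"
  obtains I' M' m where
    "I = rev [a + 1..<a + b + 1] @ I'" "M = replicate (b - 1) 0 @ m # M'"
    "count_columns {1..a + 1} (rothe n v) = b + m"
    "orthodontia vstart I' M'"
proof -
  have "orthodontia wstart I M" using assms by (simp add: orthodontic_sequence_def wstart_def)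
  moreover have "a < a + b" using b_pos by simp
  ultimately have "\<exists>I' M' D'. I = rev [a + 1..<a + b + 1] @ I'
    \<and> M = replicate (a + b - a - 1) 0 @ count_columns {1..a + 1} D' # M'
    \<and> (\<forall>j. column D' j = slide a (a + b) (column wstart j))
    \<and> orthodontia (clear_columns {{1..a + 1}} D') I' M'"
    using wcol_primary leftmost_column_wstart[OF not_standard_primary]
    by (intro orthodontia_slide column_wstart_disjoint) auto
  then show ?thesis using that count_Suc_a vstart_eqI by auto
qed

end

section \<open>From primary column data to the five claims\<close>

lemma sorted_block_primary:
  assumes w: "w permutes {1..n}" and "w \<noteq> id" and srt: "sorted_perm n w"
    and pcd: "primary_column_data n w = (h, C, \<alpha>, i\<^sub>1, \<beta>)"
  shows "sorted_block n w (h - \<beta>) \<alpha> \<beta> \<and> i\<^sub>1 = \<alpha> + \<beta>"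
proof -
  have sig: "w (\<alpha> + p) - (h - \<beta>) = p" if "p \<in> {1..\<beta>}" for p
    using fun_cong[OF srt[unfolded sorted_perm_def], of p] that by (simp add: sigma_def pcd)
  note bij = primary_column_data_bij[OF w pcd]
  \<comment> \<open>The data of a dominant permutation make its block all of \<open>{1..n}\<close>,
    so sortedness would force \<open>w = id\<close>.\<close>
  have nd: "\<not> dominant n w"
  proof
    assume "dominant n w"
    then have "\<alpha> = 0" "\<beta> = n" "h = n" using pcd by (auto simp: primary_column_data_def)
    then have "w p = p" for p using sig[of p] permutes_not_in[OF w, of p] by (cases "p \<in> {1..n}") auto
    then show False using \<open>w \<noteq> id\<close> by auto
  qed
  let ?col = "column (rothe n w)"
  let ?std = "\<lambda>h. standard_interval (?col (h + 1))"
  have hd: "h = (LEAST h. \<not> ?std h)" and Cd: "C = ?col (h + 1)"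
    and ad: "\<alpha> = (GREATEST a. {1..a} \<subseteq> C)" and i1d: "i\<^sub>1 = smallest_missing_tooth C"
    and bd: "\<beta> = i\<^sub>1 - \<alpha>"
    using pcd nd by (auto simp: primary_column_data_def Let_def)
  obtain j where "j \<in> {1..n}" "\<not> standard_interval (?col j)"
    using nd by (auto simp: dominant_def)
  then have "\<exists>h. \<not> ?std h" by (intro exI[of _ "j - 1"]) auto
  then have hn: "\<not> standard_interval C" unfolding Cd hd by (rule LeastI_ex)
  have hl: "?std k" if "k < h" for k using not_less_Least that unfolding hd by blast
  have Csub: "C \<subseteq> {1..n}" using rothe_subset unfolding Cd column_def by blast
  have "C \<noteq> {1..0}" using hn unfolding standard_interval_def by blast
  then have mt: "missing_tooth C i\<^sub>1"
    unfolding i1d using Csub hn by (intro smallest_missing_tooth) (auto intro: finite_subset)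
  \<comment> \<open>This bound makes \<open>GREATEST\<close> meaningful; the witness is
    \<open>a = 0\<close>.\<close>
  have "a \<le> n" if "{1..a} \<subseteq> C" for a
    using order_trans[OF that Csub] by (cases "a = 0") auto
  then have aC: "{1..\<alpha>} \<subseteq> C"
    unfolding ad by (intro GreatestI_nat[of "\<lambda>a. {1..a} \<subseteq> C" 0 n]) simp_all
  have ai: "\<alpha> < i\<^sub>1" using mt aC by (force simp: missing_tooth_def not_less)
  have i1: "i\<^sub>1 = \<alpha> + \<beta>" using bd ai by simp
  have Cmem: "r \<le> n \<and> h + 1 \<le> n \<and> r < inv w (h + 1) \<and> h + 1 < w r" if "r \<in> C" for r
    using that by (auto simp: Cd column_def rothe_def)
  have last: "\<alpha> + \<beta> + 1 \<in> C" using mt i1 by (simp add: missing_tooth_def)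
  have "sorted_block n w (h - \<beta>) \<alpha> \<beta>"
  proof
    fix p assume p: "p \<in> {1..\<beta>}"
    \<comment> \<open>As \<open>p\<close> is positive, the subtraction in \<open>sigma\<close> has
      not truncated.\<close>
    then show "w (\<alpha> + p) = h - \<beta> + p" using sig[OF p] by auto
  next
    fix r assume "r \<in> {1..\<alpha>}"
    then show "h - \<beta> + \<beta> + 1 < w r" using aC Cmem bij(2) by auto
  next
    fix j assume "j \<in> {1..h - \<beta> + \<beta>}"
    then show "standard_interval (?col j)" using hl[of "j - 1"] bij(2) by auto
  qed (use w ai i1 Cmem[OF last] bij(2) in auto)
  then show ?thesis using i1 by blast
qed

theorem theorem4p2:
  fixes n h \<alpha> i\<^sub>1 \<beta> :: nat and w :: "nat \<Rightarrow> nat" and C :: "nat set" and I K M :: "nat list"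
  assumes "w permutes {1..n}"
    and "w \<noteq> id"
    and "sorted_perm n w"
    and "orthodontic_sequence n w I K M"
    and "primary_column_data n w = (h, C, \<alpha>, i\<^sub>1, \<beta>)"
  shows "(\<beta> \<le> length I \<and> (\<forall>j\<in>{1..\<beta>}. I ! (j - 1) = i\<^sub>1 - j + 1)) \<and>
    (\<alpha> > 0 \<longrightarrow> K ! (\<alpha> - 1) \<ge> \<beta>) \<and>
    (\<forall>j\<in>{\<alpha> + 1..i\<^sub>1}. K ! (j - 1) = 0) \<and>
    (\<forall>j\<in>{1..\<beta> - 1}. M ! (j - 1) = 0) \<and>
    orthodontic_sequence n
      (right_mult_word w (rev [\<alpha> + 1..<i\<^sub>1 + 1]))
      (drop \<beta> I)
      (if \<alpha> > 0
       then take (\<alpha> - 1) K @ [K ! (\<alpha> - 1) - \<beta>, \<beta> + M ! (\<beta> - 1)] @ drop (\<alpha> + 1) K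
       else [\<beta> + M ! (\<beta> - 1)] @ drop 1 K)
      (drop \<beta> M)"
proof -
  interpret sorted_block n w "h - \<beta>" \<alpha> \<beta>
    using sorted_block_primary assms by blast
  have i1: "i\<^sub>1 = \<alpha> + \<beta>" using sorted_block_primary assms by blast
  obtain I' M' m where I: "I = rev [\<alpha> + 1..<\<alpha> + \<beta> + 1] @ I'"
    and M: "M = replicate (\<beta> - 1) 0 @ m # M'"
    and cnt: "count_columns {1..\<alpha> + 1} (rothe n v) = \<beta> + m"
    and orth: "orthodontia vstart I' M'"
    using orthodontic_sequence_block[OF assms(4)] .
  have K: "K = map (\<lambda>j. count_columns {1..j} (rothe n w)) [1..<n + 1]"
    using assms(4) by (simp add: orthodontic_sequence_def)
  \<comment> \<open>Lists are indexed from 0, so \<open>k_j\<close> is entry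
    \<open>j - 1\<close>.\<close>
  have Knth: "K ! (j - 1) = count_columns {1..j} (rothe n w)" if "j \<in> {1..n}" for j
    using that unfolding K by (auto simp: nth_append simp del: upt_Suc)
  have word: "right_mult_word w (rev [\<alpha> + 1..<i\<^sub>1 + 1]) = v"
    using right_mult_word_eq_row_cycle[of \<alpha> i\<^sub>1 w] i1 by (simp add: v_def)
  have dropI: "drop \<beta> I = I'" by (simp add: I)
  have dropM: "drop \<beta> M = M'" and Mb: "M ! (\<beta> - 1) = m"
    using b_pos by (simp_all add: M nth_append)
  have "I ! (j - 1) = i\<^sub>1 - j + 1" if "j \<in> {1..\<beta>}" for j
    using that i1 by (auto simp: I nth_append rev_nth simp del: upt_Suc)
  moreover have "\<beta> \<le> length I" by (simp add: I)
  moreover have "K ! (\<alpha> - 1) \<ge> \<beta>" if "\<alpha> > 0"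
    using that Knth[of \<alpha>] count_a row_bound by simp
  moreover have "K ! (j - 1) = 0" if "j \<in> {\<alpha> + 1..i\<^sub>1}" for j
    using that Knth[of j] wcol_ne_standard[of j] i1 row_bound by (simp add: count_columns_def)
  moreover have "M ! (j - 1) = 0" if "j \<in> {1..\<beta> - 1}" for j
    using that by (auto simp: M nth_append)
  moreover have "(if \<alpha> > 0
       then take (\<alpha> - 1) K @ [K ! (\<alpha> - 1) - \<beta>, \<beta> + M ! (\<beta> - 1)] @ drop (\<alpha> + 1) K
       else [\<beta> + M ! (\<beta> - 1)] @ drop 1 K)
     = map (\<lambda>j. count_columns {1..j} (rothe n v)) [1..<n + 1]" (is "?L = ?R")
  proof (rule nth_equalityI)
    have lenK: "length K = n" by (simp add: K)
    then show "length ?L = length ?R" using row_bound by auto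
    fix k assume "k < length ?L"
    then have k: "k < n" using lenK row_bound by (auto split: if_splits)
    have R: "?R ! k = count_columns {1..k + 1} (rothe n v)"
      using k by (simp del: upt_Suc)
    have Kk: "K ! k = count_columns {1..k + 1} (rothe n w)" using Knth[of "k + 1"] k by simp
    \<comment> \<open>Entry \<open>k\<close> stands for the interval \<open>{1..k + 1}\<close>; the
      first case is void when \<alpha> is 0.\<close>
    consider "k + 1 = \<alpha>" | "k = \<alpha>" | "k + 1 \<noteq> \<alpha>" "k \<noteq> \<alpha>" by blast
    then show "?L ! k = ?R ! k"
    proof cases
      case 1
      then have "?L ! k = K ! k - \<beta>" using lenK k by (auto simp: nth_append)
      then show ?thesis using 1 count_a R Kk by auto
    next
      case 2
      then have "?L ! k = \<beta> + m" using lenK k Mb by (auto simp: nth_append)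
      then show ?thesis using 2 cnt R by simp
    next
      case 3
      then consider "k < \<alpha> - 1" | "\<alpha> < k" by linarith
      then have "?L ! k = K ! k"
      proof cases
        case 2
        \<comment> \<open>\<open>d\<close> is the index in the unchanged tail
          \<open>drop (\<alpha> + 1) K\<close>, in both forms of the list.\<close>
        then obtain d where "k = \<alpha> + 1 + d" using less_iff_Suc_add by auto
        then show ?thesis using lenK k by (auto simp: nth_append)
      qed (use lenK k in \<open>auto simp: nth_append\<close>)
      then show ?thesis using 3 count_other[of "k + 1"] R Kk by simp
    qed
  qed
  ultimately show ?thesis
    using orth unfolding orthodontic_sequence_def word dropI dropM vstart_def by blast
qed

end
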